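(* If $U$ is a unipotent companion of a totally proper cyclically ordered quiver $(Q,\sigma)$ (with respect to a linear ordering compatible with $\sigma$), then $A_U=U+U^T$ is an admissible quasi-Cartan companion of $Q$.
   Context: A quiver is a finite directed graph without loops or oriented 2-cycles; multiple arrows are allowed. $K_Q$ is the underlying undirected simple graph of $Q$. Mutation $\mu_j$ of a quiver at a vertex $j$: for each path $i\to j\to k$ add an arrow $i\to k$; reverse all arrows incident to $j$; repeatedly remove oriented 2-cycles. A cyclic ordering $\sigma=(v_1,\dots,v_n)$ of the vertex set is a linear ordering $v_1<\dots<v_n$ considered up to cyclic shifts ("clockwise" placement on a circle); the $n$ linear orderings in this class are called compatible with $\sigma$. A cyclically ordered quiver (COQ) $(Q,\sigma)$ is a quiver with a cyclic ordering of its vertices. A wiggle transforms $(Q,\sigma)$ into $(Q,\sigma')$ where $\sigma'$ is obtained from $\sigma$ by interchanging two vertices that are consecutive in $\sigma$ and not adjacent in $Q$. Wiggle equivalence is the equivalence relation generated by wiggles. A path $i\to j\to k$ in $Q$ makes a right turn at $j$ if $\sigma=(\dots,i,\dots,j,\dots,k,\dots)$. A vertex $j$ is proper in $(Q,\sigma)$ if every oriented two-arrow path $i\to j\to k$ in $Q$ makes a right turn at $j$. A COQ $(Q,\sigma)$ is proper if for every vertex $j$ there is a COQ wiggle equivalent to $(Q,\sigma)$ in which $j$ is proper. Let $\operatorname{In}(j)$ (resp., $\operatorname{Out}(j)$) be the set of vertices $i$ with an arrow $i\to j$ (resp., $j\to i$) in $Q$. If $j$ is proper in $(Q,\sigma)$,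 the proper mutation $\mu_j(Q,\sigma)$ is the quiver $\mu_j(Q)$ with the cyclic ordering obtained from $\sigma$ by keeping the placement of all vertices other than $j$ and moving $j$ clockwise past all the vertices in $\operatorname{Out}(j)$ (each exactly once) without passing any vertex in $\operatorname{In}(j)$ (well defined up to wiggles; for a sink or source $j$ the cyclic ordering does not change, up to wiggles). The proper mutation class of a COQ consists of all COQs obtained from it by repeated proper mutations and wiggles. A COQ is totally proper if all COQs in its proper mutation class are proper. Given a linear ordering $v_1<\dots<v_n$ of the vertices, the exchange matrix $B=(b_{ij})$ is the skew-symmetric integer matrix with $b_{ij}=x$ if $Q$ contains $x\ge0$ arrows $v_i\to v_j$ and $b_{ij}=-x$ if $Q$ contains $x\ge 0$ arrows $v_j\to v_i$. The unipotent companion is the unique unipotent upper-triangular matrix $U$ with $-B=U-U^T$. A quasi-Cartan companion of $Q$ is a symmetric matrix $A=(a_{ij})$ (indexed by the vertices) with $|a_{ij}|=|b_{ij}|$ for $i\ne j$ and $a_{ii}=2$ for all $i$. It is admissible if for every full subquiver of $Q$ whose underlying undirected simple graph is a chordless cycle $C=(v_0-v_1-\cdots-v_k=v_0)$, the number $\#\{i\mid 0\le i<k,\ a_{v_iv_{i+1}}>0\}$ is odd if $C$ is oriented (i.e., $v_i\to v_{i+1}$ for all $i<k$ or $v_i\leftarrow v_{i+1}$ for all $i<k$), and even if $C$ is not oriented. *)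

theory Defs
  imports "Jordan_Normal_Form.Matrix"
begin

section \<open>Quivers\<close>

text \<open>\<open>q u v\<close> is the number of arrows \<open>u \<rightarrow> v\<close>; the vertex set \<open>V\<close> is carried separately.\<close>

type_synonym 'v arrows = "'v \<Rightarrow> 'v \<Rightarrow> nat"

definition quiver :: "'v set \<Rightarrow> 'v arrows \<Rightarrow> bool" where
  "quiver V q \<longleftrightarrow> finite V \<and> (\<forall>u v. 0 < q u v \<longrightarrow> u \<in> V \<and> v \<in> V)
     \<and> (\<forall>u. q u u = 0) \<and> (\<forall>u v. q u v = 0 \<or> q v u = 0)"

definition adjacent :: "'v arrows \<Rightarrow> 'v \<Rightarrow> 'v \<Rightarrow> bool" where
  "adjacent q u v \<longleftrightarrow> 0 < q u v \<or> 0 < q v u"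

definition In :: "'v arrows \<Rightarrow> 'v \<Rightarrow> 'v set" where
  "In q j = {i. 0 < q i j}"

definition Out :: "'v arrows \<Rightarrow> 'v \<Rightarrow> 'v set" where
  "Out q j = {k. 0 < q j k}"

text \<open>\<open>add_paths j q\<close> adds one arrow \<open>i \<rightarrow> k\<close> for each path \<open>i \<rightarrow> j \<rightarrow> k\<close>. In \<open>mutate\<close>, truncated
  subtraction removes a maximal collection of oriented 2-cycles between \<open>u\<close> and \<open>v\<close>; there are none
  at \<open>j\<close>, where the arrows are only reversed.\<close>

definition add_paths :: "'v \<Rightarrow> 'v arrows \<Rightarrow> 'v arrows" where
  "add_paths j q = (\<lambda>i k. q i k + q i j * q j k)"

definition mutate :: "'v \<Rightarrow> 'v arrows \<Rightarrow> 'v arrows" where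
  "mutate j q = (\<lambda>u v. if u = j \<or> v = j then q v u
                       else add_paths j q u v - add_paths j q v u)"


section \<open>Cyclically ordered quivers\<close>

text \<open>A linear ordering is a list without repetitions; a cyclic ordering is the set of all
  rotations of such a list, so its elements are exactly the compatible linear orderings.
  List order is the clockwise direction.\<close>

definition cyc :: "'v list \<Rightarrow> 'v list set" where
  "cyc vs = {rotate n vs | n. True}"

definition cyclic_ordering :: "'v set \<Rightarrow> 'v list set \<Rightarrow> bool" where
  "cyclic_ordering V \<sigma> \<longleftrightarrow> (\<exists>vs. distinct vs \<and> set vs = V \<and> \<sigma> = cyc vs)"

definition coq :: "'v set \<Rightarrow> 'v arrows \<Rightarrow> 'v list set \<Rightarrow> bool" where
  "coq V q \<sigma> \<longleftrightarrow> quiver V q \<and> cyclic_ordering V \<sigma>"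

definition wiggle :: "'v arrows \<Rightarrow> 'v list set \<Rightarrow> 'v list set \<Rightarrow> bool" where
  "wiggle q \<sigma> \<sigma>' \<longleftrightarrow> (\<exists>u v xs. \<sigma> = cyc (u # v # xs) \<and> \<sigma>' = cyc (v # u # xs) \<and> \<not> adjacent q u v)"

definition wiggle_equivalent :: "'v arrows \<Rightarrow> 'v list set \<Rightarrow> 'v list set \<Rightarrow> bool" where
  "wiggle_equivalent q = equivclp (wiggle q)"

definition clockwise :: "'v list set \<Rightarrow> 'v \<Rightarrow> 'v \<Rightarrow> 'v \<Rightarrow> bool" where
  "clockwise \<sigma> i j k \<longleftrightarrow> (\<exists>xs ys zs ws. xs @ [i] @ ys @ [j] @ zs @ [k] @ ws \<in> \<sigma>)"

definition proper_vertex :: "'v arrows \<Rightarrow> 'v list set \<Rightarrow> 'v \<Rightarrow> bool" where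
  "proper_vertex q \<sigma> j \<longleftrightarrow> (\<forall>i \<in> In q j. \<forall>k \<in> Out q j. clockwise \<sigma> i j k)"

definition proper :: "'v set \<Rightarrow> 'v arrows \<Rightarrow> 'v list set \<Rightarrow> bool" where
  "proper V q \<sigma> \<longleftrightarrow> (\<forall>j \<in> V. \<exists>\<sigma>'. wiggle_equivalent q \<sigma> \<sigma>' \<and> proper_vertex q \<sigma>' j)"

text \<open>Proper mutation of a cyclic ordering is only well defined up to wiggles, hence a relation:
  \<open>j\<close> jumps clockwise over a segment \<open>ys\<close> containing all of \<open>Out(j)\<close> and nothing of \<open>In(j)\<close>.\<close>

definition move_past_out :: "'v arrows \<Rightarrow> 'v \<Rightarrow> 'v list set \<Rightarrow> 'v list set \<Rightarrow> bool" where
  "move_past_out q j \<sigma> \<sigma>' \<longleftrightarrow> (\<exists>ys zs. \<sigma> = cyc (j # ys @ zs) \<and> \<sigma>' = cyc (ys @ j # zs)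
     \<and> Out q j \<subseteq> set ys \<and> In q j \<inter> set ys = {})"

inductive_set proper_mutation_class ::
    "'v set \<Rightarrow> 'v arrows \<Rightarrow> 'v list set \<Rightarrow> ('v arrows \<times> 'v list set) set"
  for V :: "'v set" and q :: "'v arrows" and \<sigma> :: "'v list set"
where
  start: "(q, \<sigma>) \<in> proper_mutation_class V q \<sigma>"
| wiggle: "(q', \<sigma>') \<in> proper_mutation_class V q \<sigma> \<Longrightarrow> wiggle q' \<sigma>' \<sigma>''
    \<Longrightarrow> (q', \<sigma>'') \<in> proper_mutation_class V q \<sigma>"
| mutate: "(q', \<sigma>') \<in> proper_mutation_class V q \<sigma> \<Longrightarrow> j \<in> V \<Longrightarrow> proper_vertex q' \<sigma>' j
    \<Longrightarrow> move_past_out q' j \<sigma>' \<sigma>''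
    \<Longrightarrow> (mutate j q', \<sigma>'') \<in> proper_mutation_class V q \<sigma>"

definition totally_proper :: "'v set \<Rightarrow> 'v arrows \<Rightarrow> 'v list set \<Rightarrow> bool" where
  "totally_proper V q \<sigma> \<longleftrightarrow> (\<forall>(q', \<sigma>') \<in> proper_mutation_class V q \<sigma>. proper V q' \<sigma>')"


section \<open>Companions\<close>

text \<open>In the absence of oriented 2-cycles at most one of the two terms is nonzero.\<close>

definition exchange_matrix :: "'v arrows \<Rightarrow> 'v list \<Rightarrow> int mat" where
  "exchange_matrix q vs = mat (length vs) (length vs)
     (\<lambda>(i, j). int (q (vs ! i) (vs ! j)) - int (q (vs ! j) (vs ! i)))"

definition unipotent_companion :: "'v arrows \<Rightarrow> 'v list \<Rightarrow> int mat \<Rightarrow> bool" where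
  "unipotent_companion q vs U \<longleftrightarrow>
     U \<in> carrier_mat (length vs) (length vs) \<and> upper_triangular U \<and> (\<forall>i < length vs. U $$ (i, i) = 1)
     \<and> - exchange_matrix q vs = U - transpose_mat U"

text \<open>Rewrites a matrix indexed by positions in \<open>vs\<close> as one indexed by the vertices themselves.\<close>

definition vertex_indexed :: "'v list \<Rightarrow> int mat \<Rightarrow> 'v \<Rightarrow> 'v \<Rightarrow> int" where
  "vertex_indexed vs A u v =
     (let pos = inv_into {..<length vs} ((!) vs) in A $$ (pos u, pos v))"

text \<open>\<open>\<bar>b\<^sub>u\<^sub>v\<bar>\<close> is written out as in the exchange matrix.\<close>

definition quasi_Cartan_companion :: "'v set \<Rightarrow> 'v arrows \<Rightarrow> ('v \<Rightarrow> 'v \<Rightarrow> int) \<Rightarrow> bool" where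
  "quasi_Cartan_companion V q a \<longleftrightarrow>
     (\<forall>u \<in> V. \<forall>v \<in> V. a u v = a v u)
     \<and> (\<forall>u \<in> V. \<forall>v \<in> V. u \<noteq> v \<longrightarrow> \<bar>a u v\<bar> = \<bar>int (q u v) - int (q v u)\<bar>)
     \<and> (\<forall>u \<in> V. a u u = 2)"

text \<open>The list \<open>c\<close> stands for the closed walk \<open>c ! 0 - c ! 1 - \<dots> - c ! k = c ! 0\<close> with
  \<open>k = length c\<close>; the full subquiver on \<open>set c\<close> has this cycle as its underlying simple graph.\<close>

definition chordless_cycle :: "'v set \<Rightarrow> 'v arrows \<Rightarrow> 'v list \<Rightarrow> bool" where
  "chordless_cycle V q c \<longleftrightarrow> 3 \<le> length c \<and> distinct c \<and> set c \<subseteq> V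
     \<and> (\<forall>i < length c. \<forall>j < length c. adjacent q (c ! i) (c ! j) \<longleftrightarrow>
          j = Suc i mod length c \<or> i = Suc j mod length c)"

definition oriented_cycle :: "'v arrows \<Rightarrow> 'v list \<Rightarrow> bool" where
  "oriented_cycle q c \<longleftrightarrow>
     (\<forall>i < length c. 0 < q (c ! i) (c ! (Suc i mod length c)))
     \<or> (\<forall>i < length c. 0 < q (c ! (Suc i mod length c)) (c ! i))"

definition admissible :: "'v set \<Rightarrow> 'v arrows \<Rightarrow> ('v \<Rightarrow> 'v \<Rightarrow> int) \<Rightarrow> bool" where
  "admissible V q a \<longleftrightarrow> (\<forall>c. chordless_cycle V q c \<longrightarrow>
     (odd (card {i. i < length c \<and> 0 < a (c ! i) (c ! (Suc i mod length c))})
        \<longleftrightarrow> oriented_cycle q c))"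

end

theory Submission imports Defs begin

text \<open>Call an edge of \<open>Q\<close> backward if its arrow goes against the chosen linear ordering; these are
  exactly the edges with a positive entry in \<open>A\<^sub>U\<close>. The number of backward edges of a chordless cycle
  has the parity of its winding number, which is unchanged by cyclic shifts (the
  status of both edges at the moved vertex flips) and by wiggles. If \<open>i \<rightarrow> j \<rightarrow> k\<close> is a path in a
  chordless cycle of length at least 4, then after the proper mutation at \<open>j\<close> the remaining vertices
  form a chordless cycle that is shorter by one, with the same parity since the path turns right
  at \<open>j\<close>, and oriented if and only if the original one is. If sources and sinks alternate along the
  cycle, a proper mutation at one of them keeps the parity and creates such a path. So everything
  reduces to triangles, where the right turn at \<open>j\<close> decides the claim.\<close>

fun before :: "'v list \<Rightarrow> 'v \<Rightarrow> 'v \<Rightarrow> bool" where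
  "before [] u v \<longleftrightarrow> False"
| "before (x # xs) u v \<longleftrightarrow> x = u \<and> v \<in> set xs \<or> before xs u v"

definition backward :: "'v arrows \<Rightarrow> 'v list \<Rightarrow> 'v \<Rightarrow> 'v \<Rightarrow> bool" where
  "backward q vs u v \<longleftrightarrow> 0 < q u v \<and> before vs v u \<or> 0 < q v u \<and> before vs u v"

definition edges :: "'v list \<Rightarrow> ('v \<times> 'v) list" where
  "edges c = zip c (rotate1 c)"

definition odd_wind :: "'v arrows \<Rightarrow> 'v list \<Rightarrow> 'v list \<Rightarrow> bool" where
  "odd_wind q vs c \<longleftrightarrow> odd (length (filter (\<lambda>(u, v). backward q vs u v) (edges c)))"

lemma before_append [simp]:
  "before (xs @ ys) u v \<longleftrightarrow> before xs u v \<or> before ys u v \<or> u \<in> set xs \<and> v \<in> set ys"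
  by (induction xs) auto

lemma before_in_set: "before vs u v \<Longrightarrow> u \<in> set vs \<and> v \<in> set vs"
  by (induction vs) auto

lemma before_antisym: "distinct vs \<Longrightarrow> before vs u v \<Longrightarrow> \<not> before vs v u"
  by (induction vs) (auto dest: before_in_set)

lemma before_total: "u \<in> set vs \<Longrightarrow> v \<in> set vs \<Longrightarrow> u \<noteq> v \<Longrightarrow> before vs u v \<or> before vs v u"
  by (induction vs) auto

lemma before_nth:
  assumes "distinct vs" "i < length vs" "j < length vs"
  shows "before vs (vs ! i) (vs ! j) \<longleftrightarrow> i < j"
proof -
  have *: "before vs (vs ! i) (vs ! j)" if "i < j" "j < length vs" for i j
  proof -
    have "vs = take j vs @ drop j vs" by simp
    moreover have "vs ! i \<in> set (take j vs)" "vs ! j \<in> set (drop j vs)"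
      using that by (auto simp: in_set_conv_nth Cons_nth_drop_Suc[symmetric])
    ultimately show ?thesis by (metis before_append)
  qed
  show ?thesis
    using *[of i j] *[of j i] assms before_antisym[of vs]
    by (metis before_antisym linorder_neqE_nat)
qed

lemma quiverD:
  assumes "quiver V q"
  shows "q u u = 0" "q u v = 0 \<or> q v u = 0" "0 < q u v \<Longrightarrow> u \<in> V \<and> v \<in> V"
  using assms by (auto simp: quiver_def)

lemma adjacent_sym: "adjacent q u v \<longleftrightarrow> adjacent q v u"
  by (auto simp: adjacent_def)

lemma backward_sym: "backward q vs u v \<longleftrightarrow> backward q vs v u"
  by (auto simp: backward_def)

lemma quiver_mutate:
  assumes "quiver V q" shows "quiver V (mutate j q)"
proof -
  have "u \<in> V \<and> v \<in> V" if "0 < mutate j q u v" for u v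
  proof (cases "u = j \<or> v = j")
    case True
    then show ?thesis using that quiverD(3)[OF assms] by (auto simp: mutate_def)
  next
    case False
    then have "0 < add_paths j q u v" using that by (auto simp: mutate_def)
    then show ?thesis using quiverD(3)[OF assms] by (auto simp: add_paths_def)
  qed
  then show ?thesis using assms by (auto simp: quiver_def mutate_def)
qed

section \<open>Cyclic orderings and proper mutation classes\<close>

lemma rotate_inverse: "\<exists>m. rotate m (rotate n vs) = vs"
proof -
  have "rotate (length vs - n mod length vs) (rotate n vs) =
      rotate (length vs - n mod length vs + n mod length vs) vs"
    by (metis rotate_conv_mod rotate_rotate)
  also have "\<dots> = vs"
  proof (cases "vs = []")
    case False
    then have "n mod length vs < length vs" by simp
    then have "length vs - n mod length vs + n mod length vs = length vs" by linarith
    then show ?thesis by (simp add: rotate_conv_mod[of "length vs"])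
  qed simp
  finally show ?thesis by blast
qed

lemma cyc_refl: "vs \<in> cyc vs"
  by (auto simp: cyc_def intro: exI[of _ 0])

lemma cyc_eq:
  assumes "ws \<in> cyc vs" shows "cyc ws = cyc vs"
proof -
  obtain n where n: "ws = rotate n vs" using assms by (auto simp: cyc_def)
  obtain m where m: "rotate m ws = vs" using rotate_inverse n by blast
  have "rotate k ws \<in> cyc vs" for k unfolding n cyc_def rotate_rotate by blast
  moreover have "rotate k vs \<in> cyc ws" for k unfolding m[symmetric] cyc_def rotate_rotate by blast
  ultimately show ?thesis unfolding cyc_def by auto
qed

lemma append_in_cyc: "ys @ xs \<in> cyc (xs @ ys)"
  unfolding cyc_def using rotate_append[of xs ys] by (metis (mono_tags, lifting) mem_Collect_eq)

lemma cyc_set_distinct: "ws \<in> cyc vs \<Longrightarrow> set ws = set vs \<and> (distinct ws \<longleftrightarrow> distinct vs)"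
  by (auto simp: cyc_def)

lemma cyc_Cons_inj:
  assumes "j # xs \<in> cyc (j # ys)" "distinct (j # ys)"
  shows "xs = ys"
proof -
  obtain n where n: "j # xs = rotate n (j # ys)" using assms(1) by (auto simp: cyc_def)
  let ?l = "length (j # ys)"
  have "j = rotate n (j # ys) ! 0" using n by (metis nth_Cons_0)
  also have "\<dots> = (j # ys) ! (n mod ?l)" by (subst nth_rotate) auto
  finally have "(j # ys) ! (n mod ?l) = (j # ys) ! 0" by simp
  then have "n mod ?l = 0"
    using nth_eq_iff_index_eq[OF assms(2), of "n mod ?l" 0] by simp
  then show ?thesis using n by (metis list.inject rotate0 rotate_conv_mod id_apply)
qed

lemma coq_mem:
  assumes "coq V q \<sigma>" "vs \<in> \<sigma>"
  shows "distinct vs" "set vs = V" "\<sigma> = cyc vs"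
proof -
  obtain ws where "distinct ws" "set ws = V" "\<sigma> = cyc ws"
    using assms(1) by (auto simp: coq_def cyclic_ordering_def)
  then show "distinct vs" "set vs = V" "\<sigma> = cyc vs"
    using assms(2) cyc_set_distinct[of vs ws] cyc_eq[of vs ws] by auto
qed

lemma coq_obtain:
  assumes "coq V q \<sigma>" obtains vs where "vs \<in> \<sigma>"
  using assms cyc_refl by (metis coq_def cyclic_ordering_def)

lemma coq_start_at:
  assumes "coq V q \<sigma>" "j \<in> V" obtains rest where "j # rest \<in> \<sigma>"
proof -
  obtain vs where vs: "vs \<in> \<sigma>" using coq_obtain[OF assms(1)] .
  note m = coq_mem[OF assms(1) vs]
  obtain xs ys where "vs = xs @ j # ys" using m(2) assms(2) split_list by metis
  then have "j # ys @ xs \<in> \<sigma>" using append_in_cyc[of "j # ys" xs] m(3) by simp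
  then show ?thesis using that by blast
qed

lemma coqI: "quiver V q \<Longrightarrow> distinct vs \<Longrightarrow> set vs = V \<Longrightarrow> coq V q (cyc vs)"
  by (auto simp: coq_def cyclic_ordering_def)

lemma coq_wiggle:
  assumes "coq V q \<sigma>" "wiggle q \<sigma> \<sigma>'" shows "coq V q \<sigma>'"
proof -
  obtain u v xs where w: "\<sigma> = cyc (u # v # xs)" "\<sigma>' = cyc (v # u # xs)"
    using assms(2) by (auto simp: wiggle_def)
  have "distinct (u # v # xs)" "set (u # v # xs) = V"
    using coq_mem[OF assms(1), of "u # v # xs"] w cyc_refl by auto
  then show ?thesis unfolding w using assms(1) by (intro coqI) (auto simp: coq_def)
qed

lemma coq_move:
  assumes "coq V q \<sigma>" "move_past_out q j \<sigma> \<sigma>'" shows "coq V (mutate j q) \<sigma>'"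
proof -
  obtain ys zs where w: "\<sigma> = cyc (j # ys @ zs)" "\<sigma>' = cyc (ys @ j # zs)"
    using assms(2) by (auto simp: move_past_out_def)
  have "distinct (j # ys @ zs)" "set (j # ys @ zs) = V"
    using coq_mem[OF assms(1), of "j # ys @ zs"] w cyc_refl by auto
  then show ?thesis unfolding w using assms(1) quiver_mutate
    by (intro coqI) (auto simp: coq_def)
qed

lemma coq_class:
  assumes "coq V q \<sigma>" "(q', \<sigma>') \<in> proper_mutation_class V q \<sigma>"
  shows "coq V q' \<sigma>'"
  using assms(2)
proof induction
  case (wiggle q' \<sigma>' \<sigma>'')
  then show ?case by (metis coq_wiggle)
next
  case (mutate q' \<sigma>' j \<sigma>'')
  then show ?case by (metis coq_move)
qed (rule assms(1))

lemma wiggle_sym: "wiggle q \<sigma> \<sigma>' \<Longrightarrow> wiggle q \<sigma>' \<sigma>"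
  unfolding wiggle_def using adjacent_sym by metis

lemma wiggle_equivalent_class:
  assumes "wiggle_equivalent q' \<sigma>1 \<sigma>2" "(q', \<sigma>1) \<in> proper_mutation_class V q \<sigma>"
  shows "(q', \<sigma>2) \<in> proper_mutation_class V q \<sigma>"
  using assms(1) unfolding wiggle_equivalent_def
  by (induction rule: equivclp_induct)
    (use assms(2) in \<open>auto intro: proper_mutation_class.wiggle wiggle_sym\<close>)

lemma before_rest_if_proper:
  assumes "coq V q \<sigma>" "proper_vertex q \<sigma> j" "j # rest \<in> \<sigma>" "0 < q i j" "0 < q j k"
  shows "before rest k i"
proof -
  have "clockwise \<sigma> i j k"
    using assms by (auto simp: proper_vertex_def In_def Out_def)
  then obtain xs ys zs ws where c: "xs @ [i] @ ys @ [j] @ zs @ [k] @ ws \<in> \<sigma>"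
    by (auto simp: clockwise_def)
  note m = coq_mem[OF assms(1,3)]
  have "j # (zs @ [k] @ ws @ xs @ [i] @ ys) \<in> cyc (xs @ [i] @ ys @ [j] @ zs @ [k] @ ws)"
    using append_in_cyc[of "j # zs @ [k] @ ws" "xs @ [i] @ ys"] by simp
  also have "\<dots> = cyc (j # rest)" using c m(3) cyc_eq by blast
  finally have "rest = zs @ [k] @ ws @ xs @ [i] @ ys"
    using cyc_Cons_inj m(1) by metis
  then show ?thesis by simp
qed

lemma move_past_out_exists:
  assumes "coq V q \<sigma>" "proper_vertex q \<sigma> j" "j # rest \<in> \<sigma>"
  obtains ys zs where "rest = ys @ zs" "Out q j \<subseteq> set ys" "In q j \<inter> set ys = {}"
    "move_past_out q j \<sigma> (cyc (ys @ j # zs))"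
proof -
  let ?P = "\<lambda>x. x \<notin> In q j"
  define ys zs where "ys = takeWhile ?P rest" and "zs = dropWhile ?P rest"
  have rest: "rest = ys @ zs" by (simp add: ys_def zs_def)
  note m = coq_mem[OF assms(1,3)]
  have qv: "quiver V q" using assms(1) by (simp add: coq_def)
  have no: "In q j \<inter> set ys = {}" by (auto simp: ys_def dest: set_takeWhileD)
  have "k \<in> set ys" if k: "k \<in> Out q j" for k
  proof (rule ccontr)
    assume "k \<notin> set ys"
    have kj: "0 < q j k" using k by (simp add: Out_def)
    then have "k \<in> set (j # rest)" "k \<noteq> j" using quiverD[OF qv] m(2) by (metis, metis less_not_refl)
    then have kz: "k \<in> set zs" using \<open>k \<notin> set ys\<close> rest by auto
    then have "zs \<noteq> []" by auto
    then obtain i zs' where z: "zs = i # zs'" by (cases zs) auto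
    then have "0 < q i j"
      using hd_dropWhile[of ?P rest] by (auto simp: zs_def In_def)
    then have "before rest k i" using before_rest_if_proper[OF assms _ kj] by blast
    moreover have "i \<noteq> k" using \<open>0 < q i j\<close> kj quiverD(2)[OF qv, of i j] by auto
    ultimately show False using before_antisym[of rest k i] m(1) kz rest z by auto
  qed
  then have out: "Out q j \<subseteq> set ys" by blast
  have "move_past_out q j \<sigma> (cyc (ys @ j # zs))"
    unfolding move_past_out_def using m(3) rest out no by blast
  with rest out no show ?thesis using that by blast
qed


section \<open>Parity of the winding number\<close>

lemma length_edges [simp]: "length (edges c) = length c"
  by (simp add: edges_def)

lemma nth_edges: "i < length c \<Longrightarrow> edges c ! i = (c ! i, c ! (Suc i mod length c))"
  by (simp add: edges_def nth_rotate1)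

lemma set_edges: "set (edges c) = {(c ! i, c ! (Suc i mod length c)) | i. i < length c}"
  by (auto simp: set_conv_nth nth_edges) (metis nth_edges)

lemma edges_in_set: "(u, v) \<in> set (edges c) \<Longrightarrow> u \<in> set c \<and> v \<in> set c"
  by (auto simp: edges_def dest: set_zip_leftD set_zip_rightD)

lemma edges_Cons: "edges (x # y # xs) = (x, y) # zip (y # xs) (xs @ [x])"
  by (simp add: edges_def)

lemma edges_rotate: "edges (rotate n c) = rotate n (edges c)"
proof -
  have 1: "edges (rotate1 c) = rotate1 (edges c)" for c :: "'a list"
  proof (cases c)
    case (Cons x xs)
    show ?thesis
    proof (cases xs)
      case (Cons y ys)
      with \<open>c = x # xs\<close> show ?thesis
        using zip_append[of "y # ys" "ys @ [x]" "[x]" "[y]"] by (simp add: edges_def)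
    qed (use Cons in \<open>simp add: edges_def\<close>)
  qed (simp add: edges_def)
  show ?thesis by (induction n) (simp_all add: 1)
qed

lemma length_filter_rotate: "length (filter P (rotate n xs)) = length (filter P xs)"
proof -
  have 1: "length (filter P (rotate1 xs)) = length (filter P xs)" for xs
    by (cases xs) auto
  show ?thesis by (induction n) (simp_all add: 1)
qed

lemma odd_wind_rotate [simp]: "odd_wind q vs (rotate n c) = odd_wind q vs c"
  by (simp add: odd_wind_def edges_rotate length_filter_rotate)

lemma chordless_cycle_iff:
  "chordless_cycle V q c \<longleftrightarrow> 3 \<le> length c \<and> distinct c \<and> set c \<subseteq> V
     \<and> (\<forall>u \<in> set c. \<forall>v \<in> set c. adjacent q u v \<longleftrightarrow>
          (u, v) \<in> set (edges c) \<or> (v, u) \<in> set (edges c))"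
proof -
  have "(j = Suc i mod length c) \<longleftrightarrow> (c ! i, c ! j) \<in> set (edges c)"
    if "distinct c" "i < length c" "j < length c" for i j
  proof -
    have "Suc i mod length c < length c" using that by (metis mod_less_divisor not_less_zero gr0I)
    then show ?thesis using that by (auto simp: set_edges nth_eq_iff_index_eq)
  qed
  then show ?thesis
    unfolding chordless_cycle_def all_set_conv_all_nth by blast
qed

lemma oriented_cycle_iff:
  "oriented_cycle q c \<longleftrightarrow>
     (\<forall>(u, v) \<in> set (edges c). 0 < q u v) \<or> (\<forall>(u, v) \<in> set (edges c). 0 < q v u)"
  unfolding oriented_cycle_def set_edges by blast

lemma chordless_cycle_rotate [simp]: "chordless_cycle V q (rotate n c) = chordless_cycle V q c"
  by (simp add: chordless_cycle_iff edges_rotate)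

lemma oriented_cycle_rotate [simp]: "oriented_cycle q (rotate n c) = oriented_cycle q c"
  by (simp add: oriented_cycle_iff edges_rotate)

lemma edge_adjacent:
  "chordless_cycle V q c \<Longrightarrow> (u, v) \<in> set (edges c) \<Longrightarrow> adjacent q u v"
  by (auto simp: chordless_cycle_iff dest: edges_in_set)

text \<open>Two edges of the cycle meet \<open>x\<close>, so flipping both preserves the parity.\<close>

lemma odd_filter_edges_flip:
  assumes c: "distinct c" "3 \<le> length c" "x \<in> set c"
    and flip: "\<And>u v. (u, v) \<in> set (edges c) \<Longrightarrow> P' (u, v) \<longleftrightarrow> (P (u, v) \<longleftrightarrow> x \<noteq> u \<and> x \<noteq> v)"
  shows "odd (length (filter P' (edges c))) = odd (length (filter P (edges c)))"
proof -
  obtain xs ys where xs: "c = xs @ x # ys" using c(3) split_list by metis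
  define d where "d = rotate (length xs) c"
  have d: "d = x # ys @ xs" by (simp add: d_def xs rotate_append)
  have "length (ys @ xs) \<ge> 2" using c(2) xs by simp
  then obtain y r where yr: "ys @ xs = y # r" "r \<noteq> []"
    by (cases "ys @ xs") (auto simp: Suc_le_length_iff)
  then obtain m z where r: "r = m @ [z]" by (metis rev_exhaust)
  define M where "M = zip (y # m) (m @ [z])"
  have "zip (y # m @ [z]) (m @ [z] @ [x]) = M @ [(z, x)]"
    unfolding M_def using zip_append[of "y # m" "m @ [z]" "[z]" "[x]"] by simp
  then have e: "edges d = (x, y) # M @ [(z, x)]" by (simp add: d yr r edges_Cons)
  have dist: "x \<noteq> y" "x \<noteq> z" "x \<notin> set (y # m)" "x \<notin> set (m @ [z])"
  proof -
    have "distinct d" using c(1) by (simp add: d_def)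
    then show "x \<noteq> y" "x \<noteq> z" "x \<notin> set (y # m)" "x \<notin> set (m @ [z])"
      by (auto simp: d yr r)
  qed
  have flip': "\<And>u v. (u, v) \<in> set (edges d) \<Longrightarrow> P' (u, v) \<longleftrightarrow> (P (u, v) \<longleftrightarrow> x \<noteq> u \<and> x \<noteq> v)"
    using flip by (simp add: d_def edges_rotate)
  have "P' uv = P uv" if "uv \<in> set M" for uv
  proof -
    obtain u v where uv: "uv = (u, v)" by (cases uv)
    then have "u \<in> set (y # m)" "v \<in> set (m @ [z])"
      using that unfolding M_def by (auto dest: set_zip_leftD set_zip_rightD)
    then show ?thesis using flip'[of u v] that e dist uv by auto
  qed
  then have M: "filter P' M = filter P M" by (rule filter_cong[OF refl])
  have "odd (length (filter P' (edges d))) = odd (length (filter P (edges d)))"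
    using flip'[of x y] flip'[of z x] e by (auto simp: M)
  then show ?thesis by (simp add: d_def edges_rotate length_filter_rotate)
qed

lemma odd_wind_flip:
  assumes "chordless_cycle V q c" "x \<in> set c"
    and "\<And>u v. (u, v) \<in> set (edges c) \<Longrightarrow>
      backward q' ws u v \<longleftrightarrow> (backward q vs u v \<longleftrightarrow> x \<noteq> u \<and> x \<noteq> v)"
  shows "odd_wind q' ws c = odd_wind q vs c"
  unfolding odd_wind_def
  by (rule odd_filter_edges_flip[where x = x]) (use assms in \<open>auto simp: chordless_cycle_iff\<close>)

lemma odd_wind_cong:
  assumes "\<And>u v. (u, v) \<in> set (edges c) \<Longrightarrow> backward q' ws u v = backward q vs u v"
  shows "odd_wind q' ws c = odd_wind q vs c"
proof -
  have "filter (\<lambda>(u, v). backward q' ws u v) (edges c) = filter (\<lambda>(u, v). backward q vs u v) (edges c)"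
    by (rule filter_cong) (use assms in auto)
  then show ?thesis by (simp add: odd_wind_def)
qed

lemma odd_wind_rotate1:
  assumes "quiver V q" "distinct vs" "set vs = V" "chordless_cycle V q c"
  shows "odd_wind q (rotate1 vs) c = odd_wind q vs c"
proof (cases vs)
  case (Cons x xs)
  have x: "x \<notin> set xs" using assms(2) Cons by simp
  have flip: "backward q (xs @ [x]) u v \<longleftrightarrow> (backward q (x # xs) u v \<longleftrightarrow> x \<noteq> u \<and> x \<noteq> v)"
    if uv: "(u, v) \<in> set (edges c)" for u v
  proof -
    have adj: "adjacent q u v" using edge_adjacent[OF assms(4) uv] .
    have "u \<in> set (x # xs)" "v \<in> set (x # xs)"
      using edges_in_set[OF uv] assms(3,4) Cons by (auto simp: chordless_cycle_iff)
    moreover have "u \<noteq> v" using adj quiverD(1)[OF assms(1)] by (auto simp: adjacent_def)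
    moreover have "\<not> before xs x y" "\<not> before xs y x" for y
      using x by (auto dest: before_in_set)
    ultimately show ?thesis using adj quiverD(2)[OF assms(1), of u v] x
      unfolding adjacent_def backward_def by auto
  qed
  show ?thesis
  proof (cases "x \<in> set c")
    case True
    then show ?thesis using odd_wind_flip[OF assms(4) True flip] Cons by simp
  next
    case False
    have "odd_wind q (xs @ [x]) c = odd_wind q (x # xs) c"
      by (rule odd_wind_cong) (use flip False edges_in_set in metis)
    then show ?thesis using Cons by simp
  qed
qed simp

lemma odd_wind_cyc:
  assumes "coq V q \<sigma>" "chordless_cycle V q c" "vs \<in> \<sigma>" "ws \<in> \<sigma>"
  shows "odd_wind q ws c = odd_wind q vs c"
proof -
  note m = coq_mem[OF assms(1,3)]
  obtain n where n: "ws = rotate n vs" using m(3) assms(4) by (auto simp: cyc_def)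
  have qv: "quiver V q" using assms(1) by (simp add: coq_def)
  have "odd_wind q (rotate n vs) c = odd_wind q vs c"
  proof (induction n)
    case (Suc n)
    then show ?case using odd_wind_rotate1[OF qv _ _ assms(2), of "rotate n vs"] m by simp
  qed simp
  then show ?thesis using n by simp
qed

lemma odd_wind_wiggle:
  assumes "coq V q \<sigma>" "chordless_cycle V q c" "wiggle q \<sigma> \<sigma>'" "vs \<in> \<sigma>" "ws \<in> \<sigma>'"
  shows "odd_wind q ws c = odd_wind q vs c"
proof -
  obtain u v xs where w: "\<sigma> = cyc (u # v # xs)" "\<sigma>' = cyc (v # u # xs)" "\<not> adjacent q u v"
    using assms(3) by (auto simp: wiggle_def)
  have "odd_wind q (v # u # xs) c = odd_wind q (u # v # xs) c"
  proof (rule odd_wind_cong)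
    fix a b assume "(a, b) \<in> set (edges c)"
    then have "adjacent q a b" using edge_adjacent assms(2) by metis
    then have "\<not> (a = u \<and> b = v)" "\<not> (a = v \<and> b = u)" using w(3) adjacent_sym by metis+
    then show "backward q (v # u # xs) a b = backward q (u # v # xs) a b"
      unfolding backward_def by auto
  qed
  moreover have "odd_wind q vs c = odd_wind q (u # v # xs) c"
    using odd_wind_cyc[OF assms(1,2)] assms(4) w(1) cyc_refl by blast
  moreover have "odd_wind q ws c = odd_wind q (v # u # xs) c"
    using odd_wind_cyc[OF coq_wiggle[OF assms(1,3)] assms(2)] assms(5) w(2) cyc_refl by blast
  ultimately show ?thesis by simp
qed

lemma odd_wind_wiggle_equivalent:
  assumes "coq V q \<sigma>" "chordless_cycle V q c" "wiggle_equivalent q \<sigma> \<sigma>'" "vs \<in> \<sigma>" "ws \<in> \<sigma>'"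
  shows "odd_wind q ws c = odd_wind q vs c"
proof -
  have "coq V q \<sigma>' \<and> (\<forall>ws \<in> \<sigma>'. odd_wind q ws c = odd_wind q vs c)"
    using assms(3) unfolding wiggle_equivalent_def
  proof (induction rule: equivclp_induct)
    case base
    then show ?case using assms(1) odd_wind_cyc[OF assms(1,2,4)] by blast
  next
    case (step \<tau> \<tau>')
    then have w: "wiggle q \<tau> \<tau>'" and \<tau>: "coq V q \<tau>" using wiggle_sym by blast+
    obtain us where "us \<in> \<tau>" using coq_obtain[OF \<tau>] .
    then show ?case
      using step.IH coq_wiggle[OF \<tau> w] odd_wind_wiggle[OF \<tau> assms(2) w] by metis
  qed
  then show ?thesis using assms(5) by blast
qed

lemma chordless_cycle_Cons3:
  assumes "chordless_cycle V q (i # j # k # r)" "r \<noteq> []"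
  shows "\<not> adjacent q i k" "x \<in> set r \<Longrightarrow> \<not> adjacent q j x"
    "adjacent q i j" "adjacent q j k"
proof -
  let ?c = "i # j # k # r"
  have d: "distinct ?c" using assms(1) by (simp add: chordless_cycle_iff)
  obtain a s where r: "r = a # s" using assms(2) by (cases r) auto
  have e: "edges ?c = (i, j) # (j, k) # zip (k # r) (r @ [i])"
    by (simp add: edges_def)
  have z: "u \<in> set (k # r) \<and> v \<in> set (r @ [i])" if "(u, v) \<in> set (zip (k # r) (r @ [i]))" for u v
    using that by (auto dest: set_zip_leftD set_zip_rightD simp del: zip_Cons_Cons zip_Cons)
  have "(k, i) \<notin> set (zip (k # r) (r @ [i]))"
    using d r by (auto dest: set_zip_leftD)
  then have "(k, i) \<notin> set (edges ?c)" "(i, k) \<notin> set (edges ?c)"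
    using d e z[of i k] by auto
  then show "\<not> adjacent q i k"
    using assms(1) unfolding chordless_cycle_iff by auto
  show "\<not> adjacent q j x" if x: "x \<in> set r"
  proof -
    have "(j, x) \<notin> set (edges ?c)" "(x, j) \<notin> set (edges ?c)"
      using d e z[of j x] z[of x j] x by auto
    then show ?thesis using assms(1) x unfolding chordless_cycle_iff by auto
  qed
  show "adjacent q i j" "adjacent q j k"
    using edge_adjacent[OF assms(1)] e by auto
qed

section \<open>Mutation at a vertex of a chordless cycle\<close>

lemma mutate_contract:
  assumes q: "quiver V q" and c: "chordless_cycle V q (i # j # k # r)" "r \<noteq> []"
    and uv: "u \<in> set (i # k # r)" "v \<in> set (i # k # r)"
  shows "mutate j q u v = (if u = i \<and> v = k then q i j * q j k
    else if u = k \<and> v = i then q k j * q j i else q u v)"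
proof -
  have d: "distinct (i # j # k # r)" using c(1) by (simp add: chordless_cycle_iff)
  have r: "q x j = 0 \<and> q j x = 0" if "x \<in> set r" for x
    using chordless_cycle_Cons3(2)[OF c that] by (auto simp: adjacent_def)
  have ik: "q i k = 0" "q k i = 0"
    using chordless_cycle_Cons3(1)[OF c] by (auto simp: adjacent_def)
  have two: "q i j = 0 \<or> q j i = 0" "q k j = 0 \<or> q j k = 0" "q u v = 0 \<or> q v u = 0"
    using quiverD(2)[OF q] by auto
  have mut: "mutate j q u v = (q u v + q u j * q j v) - (q v u + q v j * q j u)"
    using uv d by (auto simp: mutate_def add_paths_def)
  consider "u = i" "v = k" | "u = k" "v = i" | "\<not> (u = i \<and> v = k)" "\<not> (u = k \<and> v = i)" by blast
  then show ?thesis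
  proof cases
    case 1
    then show ?thesis using mut ik two(1) by auto
  next
    case 2
    then show ?thesis using mut ik two(1) d by auto
  next
    case 3
    have "q u j * q j v = 0" "q v j * q j u = 0"
      using uv r two(1,2) 3 by auto
    then have "mutate j q u v = q u v" using mut two(3) by auto
    then show ?thesis using 3 by presburger
  qed
qed

lemma contract_path:
  assumes q: "quiver V q" and c: "chordless_cycle V q (i # j # k # r)" "r \<noteq> []"
    and vs: "distinct (j # ys @ zs)"
    and path: "0 < q i j \<and> 0 < q j k \<and> before (ys @ zs) k i \<or>
      0 < q k j \<and> 0 < q j i \<and> before (ys @ zs) i k"
  shows "chordless_cycle V (mutate j q) (i # k # r)"
    and "oriented_cycle (mutate j q) (i # k # r) \<longleftrightarrow> oriented_cycle q (i # j # k # r)"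
    and "odd_wind (mutate j q) (ys @ j # zs) (i # k # r) = odd_wind q (j # ys @ zs) (i # j # k # r)"
proof -
  let ?c = "i # j # k # r" and ?c' = "i # k # r" and ?q = "mutate j q"
  define M where "M = zip (k # r) (r @ [i])"
  have e: "edges ?c = (i, j) # (j, k) # M" "edges ?c' = (i, k) # M"
    by (simp_all add: M_def edges_def)
  have d: "distinct ?c" using c(1) by (simp add: chordless_cycle_iff)
  have M: "u \<in> set (k # r) \<and> v \<in> set (r @ [i])" if "(u, v) \<in> set M" for u v
    using that unfolding M_def by (meson set_zip_leftD set_zip_rightD)
  have two: "q i j = 0 \<or> q j i = 0" "q k j = 0 \<or> q j k = 0"
    using quiverD(2)[OF q] by auto
  note mut = mutate_contract[OF q c]
  have nik: "(i, k) \<notin> set M" "(k, i) \<notin> set M"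
  proof -
    have "adjacent q u v" if "(u, v) \<in> set M" for u v
      using edge_adjacent[OF c(1)] e(1) that by auto
    then show "(i, k) \<notin> set M" "(k, i) \<notin> set M"
      using chordless_cycle_Cons3(1)[OF c] adjacent_sym by metis+
  qed
  have mutM: "?q u v = q u v" "?q v u = q v u" if "(u, v) \<in> set M" for u v
  proof -
    have "u \<in> set ?c'" "v \<in> set ?c'" "\<not> (u = i \<and> v = k)" "\<not> (u = k \<and> v = i)"
      "\<not> (v = i \<and> u = k)" "\<not> (v = k \<and> u = i)"
      using M[OF that] nik that by auto
    then show "?q u v = q u v" "?q v u = q v u"
      using mut[of u v] mut[of v u] by (simp_all only: simp_thms if_False)
  qed
  have mutik: "?q i k = q i j * q j k" "?q k i = q k j * q j i"
    using mut[of i k] mut[of k i] d by auto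
  have adjc: "adjacent q u v \<longleftrightarrow> (u, v) \<in> set M \<or> (v, u) \<in> set M"
    if "u \<in> set ?c'" "v \<in> set ?c'" for u v
  proof -
    have "u \<noteq> j" "v \<noteq> j" using that d by auto
    moreover have "u \<in> set ?c" "v \<in> set ?c" using that by auto
    then have "adjacent q u v \<longleftrightarrow> (u, v) \<in> set (edges ?c) \<or> (v, u) \<in> set (edges ?c)"
      using c(1) unfolding chordless_cycle_iff by blast
    ultimately show ?thesis by (simp add: e(1))
  qed
  have "adjacent ?q u v \<longleftrightarrow> (u, v) \<in> set (edges ?c') \<or> (v, u) \<in> set (edges ?c')"
    if uv: "u \<in> set ?c'" "v \<in> set ?c'" for u v
  proof (cases "u = i \<and> v = k \<or> u = k \<and> v = i")
    case True
    have ik: "adjacent ?q i k" using path by (auto simp: adjacent_def mutik)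
    then have ki: "adjacent ?q k i" by (simp only: adjacent_sym[of ?q k i])
    have mem: "(i, k) \<in> set (edges ?c')" by (simp add: e(2))
    from True show ?thesis
    proof (elim disjE conjE)
      assume "u = i" "v = k"
      then show ?thesis by (simp only: ik mem simp_thms)
    next
      assume "u = k" "v = i"
      then show ?thesis by (simp only: ki mem simp_thms)
    qed
  next
    case False
    then have n: "\<not> (u = i \<and> v = k)" "\<not> (u = k \<and> v = i)"
      "\<not> (v = i \<and> u = k)" "\<not> (v = k \<and> u = i)"
      by blast+
    have "?q u v = q u v" "?q v u = q v u"
      using mut[OF uv] mut[OF uv(2,1)] by (simp_all only: n if_False)
    then have "adjacent ?q u v = adjacent q u v" by (simp add: adjacent_def)
    then show ?thesis using adjc[OF uv] e(2) False by auto
  qed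
  moreover have "3 \<le> length ?c'" using c(2) by (cases r) auto
  moreover have "distinct ?c'" "set ?c' \<subseteq> V" using c(1) by (auto simp: chordless_cycle_iff)
  ultimately show "chordless_cycle V ?q ?c'" unfolding chordless_cycle_iff by blast
  have "(\<forall>(u, v) \<in> set M. 0 < ?q u v) \<longleftrightarrow> (\<forall>(u, v) \<in> set M. 0 < q u v)"
    "(\<forall>(u, v) \<in> set M. 0 < ?q v u) \<longleftrightarrow> (\<forall>(u, v) \<in> set M. 0 < q v u)"
    using mutM by force+
  then show "oriented_cycle ?q ?c' \<longleftrightarrow> oriented_cycle q ?c"
    unfolding oriented_cycle_iff e using mutik by auto
  have bef: "before (ys @ j # zs) u v \<longleftrightarrow> before (ys @ zs) u v"
    "before (j # ys @ zs) u v \<longleftrightarrow> before (ys @ zs) u v" if "u \<noteq> j" "v \<noteq> j" for u v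
    using that by auto
  have F: "filter (\<lambda>(u, v). backward ?q (ys @ j # zs) u v) M
      = filter (\<lambda>(u, v). backward q (j # ys @ zs) u v) M"
  proof (rule filter_cong[OF refl])
    fix x assume "x \<in> set M"
    moreover obtain u v where x: "x = (u, v)" by (cases x)
    ultimately have uv: "(u, v) \<in> set M" by simp
    then have "u \<noteq> j" "v \<noteq> j" using M[OF uv] d by auto
    then show "(case x of (u, v) \<Rightarrow> backward ?q (ys @ j # zs) u v)
        = (case x of (u, v) \<Rightarrow> backward q (j # ys @ zs) u v)"
      unfolding x prod.case backward_def by (simp only: bef mutM[OF uv] simp_thms)
  qed
  have ne: "i \<noteq> j" "k \<noteq> j" "j \<noteq> i" "j \<noteq> k" using d by auto
  have ba: "backward ?q (ys @ j # zs) i k \<longleftrightarrow>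
      (backward q (j # ys @ zs) i j \<longleftrightarrow> \<not> backward q (j # ys @ zs) j k)"
  proof -
    have *: "distinct (ys @ zs)" "j \<notin> set (ys @ zs)" using vs by auto
    have 1: "before (j # ys @ zs) j x \<longleftrightarrow> x \<in> set (ys @ zs)" "\<not> before (j # ys @ zs) x j"
      if "x \<noteq> j" for x
      using * that by (auto dest: before_in_set)
    show ?thesis
      using path
    proof
      assume p: "0 < q i j \<and> 0 < q j k \<and> before (ys @ zs) k i"
      then have "i \<in> set (ys @ zs)" "k \<in> set (ys @ zs)" using before_in_set by metis+
      then show ?thesis
        unfolding backward_def mutik bef[OF ne(1,2)] bef[OF ne(2,1)] using p two 1 ne by auto
    next
      assume p: "0 < q k j \<and> 0 < q j i \<and> before (ys @ zs) i k"
      then have "i \<in> set (ys @ zs)" "k \<in> set (ys @ zs)" using before_in_set by metis+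
      then show ?thesis
        unfolding backward_def mutik bef[OF ne(1,2)] bef[OF ne(2,1)] using p two 1 ne by auto
    qed
  qed
  show "odd_wind ?q (ys @ j # zs) ?c' = odd_wind q (j # ys @ zs) ?c"
    unfolding odd_wind_def e using F ba by auto
qed

lemma totally_proper_proper_vertex:
  assumes "totally_proper V q0 \<sigma>0" "(q, \<sigma>) \<in> proper_mutation_class V q0 \<sigma>0" "j \<in> V"
  obtains \<tau> where "wiggle_equivalent q \<sigma> \<tau>" "proper_vertex q \<tau> j"
    "(q, \<tau>) \<in> proper_mutation_class V q0 \<sigma>0"
proof -
  have "proper V q \<sigma>" using assms(1,2) by (auto simp: totally_proper_def)
  then obtain \<tau> where "wiggle_equivalent q \<sigma> \<tau>" "proper_vertex q \<tau> j"
    using assms(3) by (auto simp: proper_def)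
  then show ?thesis using that wiggle_equivalent_class assms(2) by metis
qed

lemma odd_wind_triangle:
  assumes q: "quiver V q" and c: "chordless_cycle V q [i, j, k]"
    and vs: "distinct (j # rest)" "set (j # rest) = V"
    and path: "0 < q i j \<and> 0 < q j k \<and> before rest k i \<or>
      0 < q k j \<and> 0 < q j i \<and> before rest i k"
  shows "odd_wind q (j # rest) [i, j, k] \<longleftrightarrow> oriented_cycle q [i, j, k]"
proof -
  have e: "edges [i, j, k] = [(i, j), (j, k), (k, i)]" by (simp add: edges_def)
  have d: "distinct [i, j, k]" and V: "i \<in> V" "k \<in> V"
    using c by (auto simp: chordless_cycle_iff)
  have r: "i \<in> set rest" "k \<in> set rest" using V vs d by auto
  have j: "\<not> before rest j x" "\<not> before rest x j" for x
    using vs by (auto dest: before_in_set)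
  have ki: "adjacent q k i" using edge_adjacent[OF c, of k i] e by simp
  have two: "q i j = 0 \<or> q j i = 0" "q k j = 0 \<or> q j k = 0" "q i k = 0 \<or> q k i = 0"
    using quiverD(2)[OF q] by auto
  have as: "before rest k i \<Longrightarrow> \<not> before rest i k" using before_antisym[of rest] vs by auto
  have bj: "before (j # rest) j i" "before (j # rest) j k" "\<not> before (j # rest) i j"
    "\<not> before (j # rest) k j" "before (j # rest) k i = before rest k i"
    "before (j # rest) i k = before rest i k"
    using r j d by auto
  show ?thesis
    using path
  proof
    assume p: "0 < q i j \<and> 0 < q j k \<and> before rest k i"
    then have z: "q j i = 0" "q k j = 0" using two by auto
    have "backward q (j # rest) i j" "\<not> backward q (j # rest) j k"
      "backward q (j # rest) k i \<longleftrightarrow> q k i = 0"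
      using p z bj as ki two(3) by (auto simp: backward_def adjacent_def)
    then show ?thesis unfolding odd_wind_def oriented_cycle_iff e using p z by auto
  next
    assume p: "0 < q k j \<and> 0 < q j i \<and> before rest i k"
    then have z: "q i j = 0" "q j k = 0" using two by auto
    have "\<not> backward q (j # rest) i j" "backward q (j # rest) j k"
      "backward q (j # rest) k i \<longleftrightarrow> q i k = 0"
      using p z bj as ki two(3) by (auto simp: backward_def adjacent_def)
    then show ?thesis unfolding odd_wind_def oriented_cycle_iff e using p z by auto
  qed
qed

lemma mutate_source_or_sink:
  assumes q: "quiver V q" and c: "chordless_cycle V q c" "j \<in> set c"
    and vs: "distinct (j # ys @ zs)" "set (j # ys @ zs) = V"
    and move: "Out q j \<subseteq> set ys" "In q j \<inter> set ys = {}"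
    and ext: "(\<forall>x \<in> set c. q j x = 0) \<or> (\<forall>x \<in> set c. q x j = 0)"
  shows "u \<in> set c \<Longrightarrow> v \<in> set c \<Longrightarrow>
      mutate j q u v = (if u = j \<or> v = j then q v u else q u v)"
    and "chordless_cycle V (mutate j q) c"
    and "odd_wind (mutate j q) (ys @ j # zs) c = odd_wind q (j # ys @ zs) c"
proof -
  let ?q = "mutate j q"
  have mut: "?q u v = (if u = j \<or> v = j then q v u else q u v)"
    if "u \<in> set c" "v \<in> set c" for u v
    using ext that quiverD(2)[OF q, of u v] by (auto simp: mutate_def add_paths_def)
  then show "u \<in> set c \<Longrightarrow> v \<in> set c \<Longrightarrow>
      ?q u v = (if u = j \<or> v = j then q v u else q u v)" .
  have "adjacent ?q u v = adjacent q u v" if "u \<in> set c" "v \<in> set c" for u v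
    using mut[OF that] mut[OF that(2,1)] by (auto simp: adjacent_def)
  then show "chordless_cycle V ?q c" using c(1) by (simp add: chordless_cycle_iff)
  have away: "backward ?q (ys @ j # zs) u v = backward q (j # ys @ zs) u v"
    if "u \<in> set c" "v \<in> set c" "u \<noteq> j" "v \<noteq> j" for u v
    using that mut[OF that(1,2)] mut[OF that(2,1)] by (auto simp: backward_def)
  have j: "\<not> before ys j x" "\<not> before ys x j" "\<not> before zs j x" "\<not> before zs x j" for x
    using vs by (auto dest: before_in_set)
  have inc: "x \<in> set c \<and> x \<noteq> j \<and> adjacent q j x \<and> x \<in> set ys \<union> set zs"
    if "(j, x) \<in> set (edges c) \<or> (x, j) \<in> set (edges c)" for x
  proof -
    have x: "x \<in> set c" using that edges_in_set by metis
    moreover have "adjacent q j x" using that edge_adjacent[OF c(1)] adjacent_sym by metis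
    moreover have "x \<noteq> j" using \<open>adjacent q j x\<close> quiverD(1)[OF q] by (auto simp: adjacent_def)
    moreover have "x \<in> V" using x c by (auto simp: chordless_cycle_iff)
    ultimately show ?thesis using vs(2) by auto
  qed
  show "odd_wind ?q (ys @ j # zs) c = odd_wind q (j # ys @ zs) c"
    using ext
  proof
    assume sink: "\<forall>x \<in> set c. q j x = 0"
    have at_j: "\<not> backward ?q (ys @ j # zs) j x" "backward q (j # ys @ zs) j x"
      if "(j, x) \<in> set (edges c) \<or> (x, j) \<in> set (edges c)" for x
    proof -
      note x = inc[OF that]
      then have "q j x = 0" "0 < q x j" using sink by (auto simp: adjacent_def)
      moreover from this have "x \<notin> set ys" "x \<in> set zs" using x move(2) by (auto simp: In_def)
      ultimately show "\<not> backward ?q (ys @ j # zs) j x" "backward q (j # ys @ zs) j x"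
        using mut[OF c(2), of x] mut[OF _ c(2), of x] x j vs by (auto simp: backward_def)
    qed
    show ?thesis
    proof (rule odd_wind_flip[OF c])
      fix u v assume uv: "(u, v) \<in> set (edges c)"
      show "backward ?q (ys @ j # zs) u v \<longleftrightarrow> (backward q (j # ys @ zs) u v \<longleftrightarrow> j \<noteq> u \<and> j \<noteq> v)"
        using at_j[of u] at_j[of v] uv away[of u v] edges_in_set[OF uv] backward_sym by metis
    qed
  next
    assume source: "\<forall>x \<in> set c. q x j = 0"
    have at_j: "\<not> backward ?q (ys @ j # zs) j x" "\<not> backward q (j # ys @ zs) j x"
      if "(j, x) \<in> set (edges c) \<or> (x, j) \<in> set (edges c)" for x
    proof -
      note x = inc[OF that]
      then have "q x j = 0" "0 < q j x" using source by (auto simp: adjacent_def)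
      moreover from this have "x \<in> set ys" "x \<notin> set zs" using x move(1) vs by (auto simp: Out_def)
      ultimately show "\<not> backward ?q (ys @ j # zs) j x" "\<not> backward q (j # ys @ zs) j x"
        using mut[OF c(2), of x] mut[OF _ c(2), of x] x j vs by (auto simp: backward_def)
    qed
    show ?thesis
    proof (rule odd_wind_cong)
      fix u v assume uv: "(u, v) \<in> set (edges c)"
      show "backward ?q (ys @ j # zs) u v = backward q (j # ys @ zs) u v"
        using at_j[of u] at_j[of v] uv away[of u v] edges_in_set[OF uv] backward_sym by metis
    qed
  qed
qed

context
  fixes V :: "'v set" and q0 :: "'v arrows" and \<sigma>0 :: "'v list set"
  assumes coq0: "coq V q0 \<sigma>0" and tp: "totally_proper V q0 \<sigma>0"
begin

lemma odd_wind_iff_oriented_path: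
  assumes IH: "\<And>q' \<sigma>' vs' c'. length c' < length (i # j # k # r) \<Longrightarrow>
      (q', \<sigma>') \<in> proper_mutation_class V q0 \<sigma>0 \<Longrightarrow> vs' \<in> \<sigma>' \<Longrightarrow>
      chordless_cycle V q' c' \<Longrightarrow> odd_wind q' vs' c' \<longleftrightarrow> oriented_cycle q' c'"
    and cl: "(q, \<sigma>) \<in> proper_mutation_class V q0 \<sigma>0" and vs: "vs \<in> \<sigma>"
    and c: "chordless_cycle V q (i # j # k # r)"
    and path: "0 < q i j \<and> 0 < q j k \<or> 0 < q k j \<and> 0 < q j i"
  shows "odd_wind q vs (i # j # k # r) \<longleftrightarrow> oriented_cycle q (i # j # k # r)"
proof -
  have j: "j \<in> V" using c by (auto simp: chordless_cycle_iff)
  obtain \<tau> where w: "wiggle_equivalent q \<sigma> \<tau>" and p: "proper_vertex q \<tau> j"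
    and \<tau>: "(q, \<tau>) \<in> proper_mutation_class V q0 \<sigma>0"
    using totally_proper_proper_vertex[OF tp cl j] .
  note coq\<tau> = coq_class[OF coq0 \<tau>]
  have q: "quiver V q" using coq\<tau> by (simp add: coq_def)
  obtain rest where rest: "j # rest \<in> \<tau>" using coq_start_at[OF coq\<tau> j] .
  note m = coq_mem[OF coq\<tau> rest]
  have path': "0 < q i j \<and> 0 < q j k \<and> before rest k i \<or>
      0 < q k j \<and> 0 < q j i \<and> before rest i k"
    using path before_rest_if_proper[OF coq\<tau> p rest] by blast
  have w': "odd_wind q (j # rest) (i # j # k # r) = odd_wind q vs (i # j # k # r)"
    using odd_wind_wiggle_equivalent[OF coq_class[OF coq0 cl] c w vs rest] .
  show ?thesis
  proof (cases "r = []")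
    case True
    then show ?thesis using odd_wind_triangle[OF q _ m(1,2) path'] c w' by simp
  next
    case False
    obtain ys zs where yz: "rest = ys @ zs" "move_past_out q j \<tau> (cyc (ys @ j # zs))"
      using move_past_out_exists[OF coq\<tau> p rest] by metis
    have cl': "(mutate j q, cyc (ys @ j # zs)) \<in> proper_mutation_class V q0 \<sigma>0"
      using proper_mutation_class.mutate[OF \<tau> j p yz(2)] .
    note con = contract_path[OF q c False m(1)[unfolded yz(1)] path'[unfolded yz(1)]]
    have "odd_wind (mutate j q) (ys @ j # zs) (i # k # r) \<longleftrightarrow> oriented_cycle (mutate j q) (i # k # r)"
      using IH[OF _ cl' cyc_refl con(1)] by simp
    then show ?thesis using con(2,3) w' yz(1) by simp
  qed
qed

lemma odd_wind_iff_oriented: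
  assumes "(q, \<sigma>) \<in> proper_mutation_class V q0 \<sigma>0" "vs \<in> \<sigma>" "chordless_cycle V q c"
  shows "odd_wind q vs c \<longleftrightarrow> oriented_cycle q c"
  using assms
proof (induction "length c" arbitrary: q \<sigma> vs c rule: less_induct)
  case less
  have rot: ?case
    if d: "rotate n c = i # j # k # r"
      and p: "0 < q i j \<and> 0 < q j k \<or> 0 < q k j \<and> 0 < q j i" for n i j k r
  proof -
    have len: "length (i # j # k # r) = length c" using d by (metis length_rotate)
    have "chordless_cycle V q (i # j # k # r)" using less.prems(3) d by (metis chordless_cycle_rotate)
    from _ less.prems(1,2) this p
    have "odd_wind q vs (i # j # k # r) \<longleftrightarrow> oriented_cycle q (i # j # k # r)"
    proof (rule odd_wind_iff_oriented_path)
      fix q' \<sigma>' vs' and c' :: "'v list"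
      assume a: "length c' < length (i # j # k # r)" "(q', \<sigma>') \<in> proper_mutation_class V q0 \<sigma>0"
        "vs' \<in> \<sigma>'" "chordless_cycle V q' c'"
      show "odd_wind q' vs' c' \<longleftrightarrow> oriented_cycle q' c'"
        by (rule less.hyps[OF _ a(2-4)]) (use a(1) len in simp)
    qed
    then show ?thesis unfolding d[symmetric] odd_wind_rotate oriented_cycle_rotate .
  qed
  have "3 \<le> length c" using less.prems(3) by (simp add: chordless_cycle_iff)
  then obtain i j k r where c: "c = i # j # k # r"
    by (auto simp: numeral_3_eq_3 Suc_le_length_iff)
  have q: "quiver V q" using coq_class[OF coq0 less.prems(1)] by (simp add: coq_def)
  have two: "q x y = 0 \<or> q y x = 0" for x y using quiverD(2)[OF q] .
  have e: "edges c = (i, j) # (j, k) # zip (k # r) (r @ [i])" by (simp add: c edges_def)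
  then have adj: "adjacent q i j" "adjacent q j k" using edge_adjacent[OF less.prems(3)] by auto
  show ?case
  proof (cases "0 < q i j \<and> 0 < q j k \<or> 0 < q k j \<and> 0 < q j i")
    case True
    then show ?thesis using rot[of 0 i j k r] c by simp
  next
    case nj: False
    show ?thesis
    proof (cases r)
      case Nil
      then have "adjacent q k i" using edge_adjacent[OF less.prems(3)] e by auto
      then have "(0 < q j k \<and> 0 < q k i \<or> 0 < q i k \<and> 0 < q k j) \<or>
          (0 < q k i \<and> 0 < q i j \<or> 0 < q j i \<and> 0 < q i k)"
        using adj nj by (auto simp: adjacent_def)
      moreover have "rotate 1 c = [j, k, i]" "rotate 2 c = [k, i, j]"
        using Nil by (simp_all add: c numeral_2_eq_2)
      ultimately show ?thesis using rot by blast
    next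
      case (Cons l s)
      have d: "rotate 1 c = j # k # l # s @ [i]" using Cons by (simp add: c)
      have adjl: "adjacent q k l" using edge_adjacent[OF less.prems(3)] e Cons by auto
      show ?thesis
      proof (cases "0 < q j k \<and> 0 < q k l \<or> 0 < q l k \<and> 0 < q k j")
        case True
        then show ?thesis using rot[OF d] by blast
      next
        case nk: False
        have dist: "distinct c" and j: "j \<in> set c" "j \<in> V"
          using less.prems(3) by (auto simp: chordless_cycle_iff c)
        have alt: "0 < q i j \<and> 0 < q k j \<and> 0 < q k l \<or> 0 < q j i \<and> 0 < q j k \<and> 0 < q l k"
          using nj nk adj adjl by (auto simp: adjacent_def)
        have "q j x = 0 \<and> q x j = 0" if "x \<in> set r" for x
          using chordless_cycle_Cons3(2)[of V q i j k r] less.prems(3) c Cons that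
          by (auto simp: adjacent_def)
        then have ext: "(\<forall>x \<in> set c. q j x = 0) \<or> (\<forall>x \<in> set c. q x j = 0)"
          using alt two[of i j] two[of j k] two[of j j] by (auto simp: c)
        obtain \<tau> where w: "wiggle_equivalent q \<sigma> \<tau>" and p: "proper_vertex q \<tau> j"
          and \<tau>: "(q, \<tau>) \<in> proper_mutation_class V q0 \<sigma>0"
          using totally_proper_proper_vertex[OF tp less.prems(1) j(2)] .
        note coq\<tau> = coq_class[OF coq0 \<tau>]
        obtain rest where rest: "j # rest \<in> \<tau>" using coq_start_at[OF coq\<tau> j(2)] .
        obtain ys zs where yz: "rest = ys @ zs" "Out q j \<subseteq> set ys" "In q j \<inter> set ys = {}"
          "move_past_out q j \<tau> (cyc (ys @ j # zs))"
          using move_past_out_exists[OF coq\<tau> p rest] .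
        let ?q = "mutate j q"
        have cl': "(?q, cyc (ys @ j # zs)) \<in> proper_mutation_class V q0 \<sigma>0"
          using proper_mutation_class.mutate[OF \<tau> j(2) p yz(4)] .
        note m = coq_mem[OF coq\<tau> rest, unfolded yz(1)]
        note mut = mutate_source_or_sink[OF q less.prems(3) j(1) m(1,2) yz(2,3) ext]
        have q': "?q i j = q j i" "?q j i = q i j" "?q j k = q k j" "?q k j = q j k"
          "?q k l = q k l" "?q l k = q l k"
          using mut(1)[of i j] mut(1)[of j i] mut(1)[of j k] mut(1)[of k j] mut(1)[of k l]
            mut(1)[of l k] dist by (auto simp: c Cons)
        have "odd_wind ?q (ys @ j # zs) (j # k # l # s @ [i]) \<longleftrightarrow>
            oriented_cycle ?q (j # k # l # s @ [i])"
        proof (rule odd_wind_iff_oriented_path[OF _ cl' cyc_refl])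
          show "chordless_cycle V ?q (j # k # l # s @ [i])"
            unfolding d[symmetric] chordless_cycle_rotate by (rule mut(2))
          show "0 < ?q j k \<and> 0 < ?q k l \<or> 0 < ?q l k \<and> 0 < ?q k j"
            unfolding q' using alt by auto
        next
          fix q' \<sigma>' vs' and c' :: "'v list"
          assume a: "length c' < length (j # k # l # s @ [i])"
            "(q', \<sigma>') \<in> proper_mutation_class V q0 \<sigma>0" "vs' \<in> \<sigma>'" "chordless_cycle V q' c'"
          show "odd_wind q' vs' c' \<longleftrightarrow> oriented_cycle q' c'"
            by (rule less.hyps[OF _ a(2-4)]) (use a(1) in \<open>simp add: c Cons\<close>)
        qed
        then have "odd_wind ?q (ys @ j # zs) c \<longleftrightarrow> oriented_cycle ?q c"
          unfolding d[symmetric] odd_wind_rotate oriented_cycle_rotate .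
        moreover have "odd_wind q (j # ys @ zs) c = odd_wind q vs c"
          using odd_wind_wiggle_equivalent[OF coq_class[OF coq0 less.prems(1)] less.prems(3) w
              less.prems(2) rest] yz(1) by simp
        moreover have "\<not> oriented_cycle q c" "\<not> oriented_cycle ?q c"
          unfolding oriented_cycle_iff e using alt two[of i j] two[of j k]
          by (auto simp: q')
        ultimately show ?thesis using mut(3) by simp
      qed
    qed
  qed
qed

end

lemma vertex_indexed_nth:
  assumes "distinct vs" "i < length vs" "j < length vs"
  shows "vertex_indexed vs A (vs ! i) (vs ! j) = A $$ (i, j)"
proof -
  have "inj_on ((!) vs) {..<length vs}" using assms(1) by (simp add: inj_on_nth)
  then show ?thesis using assms(2,3) by (simp add: vertex_indexed_def inv_into_f_f)
qed

lemma unipotent_companion_sum_nth: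
  assumes "unipotent_companion q vs U" "i < length vs" "j < length vs"
  shows "(U + transpose_mat U) $$ (i, j) =
    (if i = j then 2
     else if i < j then int (q (vs ! j) (vs ! i)) - int (q (vs ! i) (vs ! j))
     else int (q (vs ! i) (vs ! j)) - int (q (vs ! j) (vs ! i)))"
proof -
  have U: "U \<in> carrier_mat (length vs) (length vs)" "upper_triangular U"
    "\<And>i. i < length vs \<Longrightarrow> U $$ (i, i) = 1" "- exchange_matrix q vs = U - transpose_mat U"
    using assms(1) by (auto simp: unipotent_companion_def)
  have zero: "U $$ (a, b) = 0" if "b < a" "a < length vs" for a b
    using upper_triangularD[OF U(2)] that U(1) by auto
  have diff: "U $$ (a, b) - U $$ (b, a) = int (q (vs ! b) (vs ! a)) - int (q (vs ! a) (vs ! b))"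
    if "a < length vs" "b < length vs" for a b
  proof -
    have "(- exchange_matrix q vs) $$ (a, b) = (U - transpose_mat U) $$ (a, b)" using U(4) by simp
    then show ?thesis using that U(1) by (auto simp: exchange_matrix_def)
  qed
  have "(U + transpose_mat U) $$ (i, j) = U $$ (i, j) + U $$ (j, i)"
    using assms(2,3) U(1) by auto
  then show ?thesis
    using diff[OF assms(2,3)] zero[of i j] zero[of j i] U(3) assms(2,3) by auto
qed

theorem proposition16p5:
  fixes V :: "'v set" and q :: "'v arrows" and \<sigma> :: "'v list set"
    and vs :: "'v list" and U :: "int mat"
  assumes "coq V q \<sigma>"
    and "totally_proper V q \<sigma>"
    and "vs \<in> \<sigma>"
    and "unipotent_companion q vs U"
  shows "quasi_Cartan_companion V q (vertex_indexed vs (U + transpose_mat U))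
    \<and> admissible V q (vertex_indexed vs (U + transpose_mat U))"
proof
  note vs = coq_mem[OF assms(1,3)]
  have q: "quiver V q" using assms(1) by (simp add: coq_def)
  define a where "a = vertex_indexed vs (U + transpose_mat U)"
  have a: "a u v = (if u = v then 2 else if before vs u v then int (q v u) - int (q u v)
      else int (q u v) - int (q v u))" if "u \<in> V" "v \<in> V" for u v
  proof -
    obtain i where i: "i < length vs" "u = vs ! i" using \<open>u \<in> V\<close> vs(2) by (auto simp: in_set_conv_nth)
    obtain j where j: "j < length vs" "v = vs ! j" using \<open>v \<in> V\<close> vs(2) by (auto simp: in_set_conv_nth)
    show ?thesis
      unfolding a_def i(2) j(2) vertex_indexed_nth[OF vs(1) i(1) j(1)]
        unipotent_companion_sum_nth[OF assms(4) i(1) j(1)]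
        before_nth[OF vs(1) i(1) j(1)] nth_eq_iff_index_eq[OF vs(1) i(1) j(1)] ..
  qed
  have ord: "before vs u v \<longleftrightarrow> \<not> before vs v u" if "u \<in> V" "v \<in> V" "u \<noteq> v" for u v
    using before_antisym[OF vs(1)] before_total[of u vs v] that vs(2) by blast
  have "a u v = a v u" if "u \<in> V" "v \<in> V" for u v
    using a[OF that] a[OF that(2,1)] ord[OF that] by auto
  moreover have "\<bar>a u v\<bar> = \<bar>int (q u v) - int (q v u)\<bar>" if "u \<in> V" "v \<in> V" "u \<noteq> v" for u v
    using a[OF that(1,2)] that(3) by auto
  moreover have "a u u = 2" if "u \<in> V" for u using a[OF that that] by simp
  ultimately show "quasi_Cartan_companion V q (vertex_indexed vs (U + transpose_mat U))"
    unfolding quasi_Cartan_companion_def a_def[symmetric] by blast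
  have pos: "0 < a u v \<longleftrightarrow> backward q vs u v" if "u \<in> V" "v \<in> V" "u \<noteq> v" for u v
    using a[OF that(1,2)] ord[OF that] that(3) quiverD(2)[OF q, of u v] by (auto simp: backward_def)
  show "admissible V q (vertex_indexed vs (U + transpose_mat U))"
    unfolding admissible_def a_def[symmetric]
  proof (intro allI impI)
    fix c assume c: "chordless_cycle V q c"
    have "{i. i < length c \<and> 0 < a (c ! i) (c ! (Suc i mod length c))} =
        {i. i < length (edges c) \<and> (\<lambda>(u, v). backward q vs u v) (edges c ! i)}"
    proof -
      have "0 < a (c ! i) (c ! (Suc i mod length c)) \<longleftrightarrow>
          backward q vs (c ! i) (c ! (Suc i mod length c))" if "i < length c" for i
      proof (rule pos)
        have e: "(c ! i, c ! (Suc i mod length c)) \<in> set (edges c)"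
          using that set_edges by blast
        then show "c ! i \<in> V" "c ! (Suc i mod length c) \<in> V"
          using edges_in_set[OF e] c by (auto simp: chordless_cycle_iff)
        show "c ! i \<noteq> c ! (Suc i mod length c)"
          using edge_adjacent[OF c e] quiverD(1)[OF q] by (metis adjacent_def less_not_refl)
      qed
      then show ?thesis by (auto simp: nth_edges)
    qed
    then have "odd (card {i. i < length c \<and> 0 < a (c ! i) (c ! (Suc i mod length c))})
        \<longleftrightarrow> odd_wind q vs c"
      unfolding odd_wind_def length_filter_conv_card by simp
    also have "\<dots> \<longleftrightarrow> oriented_cycle q c"
      using odd_wind_iff_oriented[OF assms(1,2) proper_mutation_class.start assms(3) c] .
    finally show "odd (card {i. i < length c \<and> 0 < a (c ! i) (c ! (Suc i mod length c))})
        \<longleftrightarrow> oriented_cycle q c" .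
  qed
qed

end
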